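(* For every positive integer $L$, $$\sum_{n,m\ge 0}\binom{m}{2}b_2(L,m,n)q^n=q^6\begin{bmatrix}L-2\\2\end{bmatrix}_{q}(-q^3;q)_{L-4}.$$
   Context: A partition of $n$ is a non-increasing finite sequence of positive integers summing to $n$ (the empty partition is the unique partition of $0$). Its Young diagram has $\lambda_i$ left-justified cells in row $i$; with $\lambda'_j$ the number of cells in column $j$, the hook length of cell $(i,j)$ is $h(i,j)=\lambda_i+\lambda'_j-i-j+1$. For a positive integer $L$, $b_2(L,m,n)$ is the number of partitions of $n$ into distinct parts with largest part at most $L$ whose Young diagram has exactly $m$ cells of hook length $2$. Notation: $(a;q)_N=\prod_{k=0}^{N-1}(1-aq^k)$ for $N\ge 0$, with the standard convention $(a;q)_N=1/(aq^{N};q)_{-N}$ for $N<0$; the Gaussian binomial coefficient is $\begin{bmatrix}M\\N\end{bmatrix}_q=\frac{(q;q)_M}{(q;q)_N(q;q)_{M-N}}$ for $M\ge N\ge 0$ and $0$ otherwise (so the right-hand side is $0$ for $L\le 3$). The identity is one of formal power series in $q$. *)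

theory Defs
  imports "HOL-Analysis.Infinite_Sum" "HOL-Computational_Algebra.Formal_Power_Series"
begin

definition is_partition :: "nat \<Rightarrow> nat list \<Rightarrow> bool" where
  "is_partition n p \<longleftrightarrow> sorted_wrt (\<ge>) p \<and> (\<forall>x\<in>set p. 0 < x) \<and> sum_list p = n"

(* Rows and columns are numbered from 1, so row i of the diagram has p ! (i - 1) cells. *)
definition row_len :: "nat list \<Rightarrow> nat \<Rightarrow> nat" where
  "row_len p i = p ! (i - 1)"

definition cells :: "nat list \<Rightarrow> (nat \<times> nat) set" where
  "cells p = {(i, j). 1 \<le> i \<and> i \<le> length p \<and> 1 \<le> j \<and> j \<le> row_len p i}"

definition col_len :: "nat list \<Rightarrow> nat \<Rightarrow> nat" where
  "col_len p j = card {i. (i, j) \<in> cells p}"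

definition hook_length :: "nat list \<Rightarrow> nat \<Rightarrow> nat \<Rightarrow> int" where
  "hook_length p i j = int (row_len p i) + int (col_len p j) - int i - int j + 1"

definition b2 :: "nat \<Rightarrow> nat \<Rightarrow> nat \<Rightarrow> nat" where
  "b2 L m n = card {p. is_partition n p \<and> distinct p \<and> (\<forall>x\<in>set p. x \<le> L) \<and>
                       card {(i, j) \<in> cells p. hook_length p i j = 2} = m}"

(* (a;q)_N for an integer N. For N < 0 the factor a q^N of the convention
   (a;q)_N = 1 / (a q^N; q)_(-N) is written as the quotient of a by q^(-N), so that the
   definition also applies in a ring such as the formal power series over a field, where q
   itself is not invertible; it has the intended meaning whenever q^(-N) divides a and the
   product is a unit. For a = -q^3 over the rationals this
   covers every N >= -3. *)
definition q_pochhammer :: "'a::idom_divide \<Rightarrow> 'a \<Rightarrow> int \<Rightarrow> 'a" where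
  "q_pochhammer a q N =
     (if 0 \<le> N then \<Prod>k<nat N. 1 - a * q ^ k
      else 1 div (\<Prod>k<nat (- N). 1 - (a div q ^ nat (- N)) * q ^ k))"

definition q_binomial :: "int \<Rightarrow> int \<Rightarrow> 'a::idom_divide \<Rightarrow> 'a" where
  "q_binomial M N q =
     (if 0 \<le> N \<and> N \<le> M
      then q_pochhammer q q M div (q_pochhammer q q N * q_pochhammer q q (M - N))
      else 0)"

end

theory Submission imports Defs
begin

text \<open>
  In a partition into distinct parts, a cell of hook length 2 has arm 1 and leg 0, so these cells
  correspond to the parts \<open>x \<ge> 2\<close> such that \<open>x - 1\<close> is not a part. Hence the left-hand side is the
  sum \<open>A\<^sub>2(L)\<close>, where \<open>A\<^sub>j(L)\<close> is the sum over \<open>S \<subseteq> {1..L}\<close> of \<open>(m(S) choose j) q^(\<Sum>S)\<close> and \<open>m(S)\<close>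
  counts the \<open>x \<in> S\<close> with \<open>x \<ge> 2\<close> and \<open>x - 1 \<notin> S\<close>. Splitting on whether \<open>L \<in> S\<close> and applying
  Pascal's rule gives \<open>A\<^sub>j(L) = (1 + q^L) A\<^sub>j(L - 1) + q^L A\<^sub>j\<^sub>-\<^sub>1(L - 2)\<close>, and the product formulas for
  \<open>A\<^sub>1\<close> and then \<open>A\<^sub>2\<close> follow by induction on \<open>L\<close>.
\<close>

section \<open>Subset sums and their recurrence\<close>

text \<open>For a set of positive integers these are the minima of its maximal runs of consecutive
  integers, a run starting at 1 left out: a row of length 1 has no cell with arm 1.\<close>

definition run_starts :: "nat set \<Rightarrow> nat set" where
  "run_starts S = {x \<in> S. 2 \<le> x \<and> x - 1 \<notin> S}"

text \<open>This is \<open>A\<^sub>j(L)\<close>, with \<open>q\<close> in any commutative ring; the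
  product formulas below therefore keep their denominators on the left.\<close>

definition run_sum :: "'a::comm_ring_1 \<Rightarrow> nat \<Rightarrow> nat \<Rightarrow> 'a" where
  "run_sum q j L = (\<Sum>S\<in>Pow {1..L}. of_nat (card (run_starts S) choose j) * q ^ \<Sum>S)"

lemma finite_run_starts: "finite S \<Longrightarrow> finite (run_starts S)"
  by (simp add: run_starts_def)

text \<open>A new maximum is nobody's predecessor in the set, so all old run starts survive, and the
  maximum itself starts a run unless \<open>Suc L\<close> is present.\<close>

lemma card_run_starts_insert:
  assumes "S \<subseteq> {1..Suc L}"
  shows "card (run_starts (insert (Suc (Suc L)) S)) =
    card (run_starts S) + (if Suc L \<in> S then 0 else 1)"
proof -
  have fin: "finite S" using assms finite_subset by blast
  have S: "x \<noteq> Suc (Suc L)" "x - 1 \<noteq> Suc (Suc L)" if "x \<in> S" for x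
    using assms that by fastforce+
  have "run_starts (insert (Suc (Suc L)) S) =
      (if Suc L \<in> S then run_starts S else insert (Suc (Suc L)) (run_starts S))"
    using S by (auto simp: run_starts_def)
  moreover have "Suc (Suc L) \<notin> run_starts S" using S(1) by (auto simp: run_starts_def)
  ultimately show ?thesis using finite_run_starts[OF fin] by simp
qed

lemma sum_Pow_insert:
  assumes "finite A" "a \<notin> A"
  shows "(\<Sum>S\<in>Pow (insert a A). f S) = (\<Sum>S\<in>Pow A. f S) + (\<Sum>S\<in>Pow A. f (insert a S))"
proof -
  have "inj_on (insert a) (Pow A)"
    using assms(2) by (auto simp: inj_on_def)
  moreover have "Pow A \<inter> insert a ` Pow A = {}" using assms(2) by auto
  ultimately show ?thesis
    using assms(1) by (simp add: Pow_insert sum.union_disjoint sum.reindex)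
qed

lemma run_sum_0: "run_sum q 0 L = (\<Prod>k<L. 1 + q ^ Suc k)"
proof (induction L)
  case (Suc L)
  have "run_sum q 0 (Suc L) = run_sum q 0 L + (\<Sum>S\<in>Pow {1..L}. q ^ \<Sum>(insert (Suc L) S))"
    by (simp add: run_sum_def atLeastAtMostSuc_conv sum_Pow_insert)
  also have "(\<Sum>S\<in>Pow {1..L}. q ^ \<Sum>(insert (Suc L) S)) = q ^ Suc L * run_sum q 0 L"
    unfolding run_sum_def sum_distrib_left
  proof (rule sum.cong)
    fix S assume "S \<in> Pow {1..L}"
    then have "finite S" "Suc L \<notin> S" using finite_subset by fastforce+
    then show "q ^ \<Sum>(insert (Suc L) S) =
        q ^ Suc L * (of_nat (card (run_starts S) choose 0) * q ^ \<Sum>S)"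
      by (simp add: power_add)
  qed simp
  finally show ?case using Suc by (simp add: algebra_simps)
qed (simp add: run_sum_def)

lemma run_sum_Suc_small: "L \<le> 1 \<Longrightarrow> run_sum q (Suc j) L = 0"
proof -
  assume "L \<le> 1"
  then have "run_starts S = {}" if "S \<subseteq> {1..L}" for S
    using that by (fastforce simp: run_starts_def)
  then show ?thesis unfolding run_sum_def by (intro sum.neutral) auto
qed

lemma run_sum_rec:
  "run_sum q (Suc j) (Suc (Suc L)) =
    (1 + q ^ Suc (Suc L)) * run_sum q (Suc j) (Suc L) + q ^ Suc (Suc L) * run_sum q j L"
proof -
  let ?m = "\<lambda>S. card (run_starts S)" and ?a = "Suc (Suc L)"
  define f where "f j S = of_nat (?m S choose j) * q ^ \<Sum>S" for j S
  have f: "run_sum q j L = (\<Sum>S\<in>Pow {1..L}. f j S)" for j L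
    by (simp add: run_sum_def f_def)
  \<comment> \<open>When \<open>Suc L\<close> is absent, the count rises by one and Pascal's rule
    contributes the extra term \<open>f j S\<close>.\<close>
  have ins: "f (Suc j) (insert ?a S) = q ^ ?a * f (Suc j) S +
      (if Suc L \<in> S then 0 else q ^ ?a * f j S)" if "S \<in> Pow {1..Suc L}" for S
  proof -
    have "finite S" "?a \<notin> S" using that finite_subset by fastforce+
    then show ?thesis
      using that by (simp add: f_def card_run_starts_insert power_add algebra_simps)
  qed
  have "run_sum q (Suc j) ?a =
      run_sum q (Suc j) (Suc L) + (\<Sum>S\<in>Pow {1..Suc L}. f (Suc j) (insert ?a S))"
  proof -
    have "{1..?a} = insert ?a {1..Suc L}" by auto
    then show ?thesis
      unfolding f using sum_Pow_insert[of "{1..Suc L}" ?a "f (Suc j)"]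
      by simp
  qed
  also have "(\<Sum>S\<in>Pow {1..Suc L}. f (Suc j) (insert ?a S)) =
      q ^ ?a * run_sum q (Suc j) (Suc L) +
      (\<Sum>S\<in>Pow {1..Suc L}. if Suc L \<in> S then 0 else q ^ ?a * f j S)"
    by (simp add: ins sum.distrib f sum_distrib_left)
  \<comment> \<open>The subsets that avoid \<open>Suc L\<close> are those of \<open>{1..L}\<close>,
    whence the drop by two in the recurrence.\<close>
  also have "(\<Sum>S\<in>Pow {1..Suc L}. if Suc L \<in> S then 0 else q ^ ?a * f j S) =
      (\<Sum>S\<in>Pow {1..L}. q ^ ?a * f j S)"
  proof (rule sum.mono_neutral_cong_right)
    show "Pow {1..L} \<subseteq> Pow {1..Suc L}" by auto
    show "\<forall>S\<in>Pow {1..Suc L} - Pow {1..L}. (if Suc L \<in> S then 0 else q ^ ?a * f j S) = 0"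
      by (auto simp: atLeastAtMostSuc_conv)
  qed auto
  finally show ?thesis
    by (simp add: f ring_distribs flip: sum_distrib_left)
qed

section \<open>Product formulas by induction\<close>

lemma run_sum_1:
  fixes q :: "'a::comm_ring_1"
  shows "(1 - q) * run_sum q 1 (L + 2) = q ^ 2 * (1 - q ^ (L + 1)) * (\<Prod>k<L. 1 + q ^ (k + 2))"
proof (induction L)
  case 0
  show ?case
    using run_sum_rec[of q 0 0] run_sum_Suc_small[of 1 q 0]
    by (simp add: run_sum_0 numeral_2_eq_2 algebra_simps)
next
  case (Suc L)
  let ?P = "\<Prod>k<L. 1 + q ^ (k + 2)"
  have 0: "run_sum q 0 (L + 1) = (1 + q) * ?P"
    unfolding run_sum_0 Suc_eq_plus1[of L, symmetric] prod.lessThan_Suc_shift by simp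
  have rec: "run_sum q 1 (L + 3) =
      (1 + q ^ (L + 3)) * run_sum q 1 (L + 2) + q ^ (L + 3) * ((1 + q) * ?P)"
    using run_sum_rec[of q 0 "L + 1"] 0 by (simp add: numeral_3_eq_3 numeral_2_eq_2)
  have "(1 - q) * run_sum q 1 (L + 3) =
      (1 + q ^ (L + 3)) * ((1 - q) * run_sum q 1 (L + 2)) + (1 - q) * q ^ (L + 3) * (1 + q) * ?P"
    unfolding rec by (simp add: algebra_simps)
  also have "\<dots> = q ^ 2 * (1 - q ^ (L + 2)) * ((1 + q ^ (L + 2)) * ?P)"
  proof -
    \<comment> \<open>Here \<open>x\<close> stands for \<open>q ^ L\<close>. Up to the factor
      \<open>q ^ 2 * P\<close> both sides are 1 - x^2 q^4, since (1 + x q^3)(1 - x q) + x q (1 -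
      q^2) telescopes to it.\<close>
    have "(1 + x * q ^ 3) * (q ^ 2 * (1 - x * q) * P) + (1 - q) * (x * q ^ 3) * (1 + q) * P =
        q ^ 2 * (1 - x * q ^ 2) * ((1 + x * q ^ 2) * P)" for x P :: 'a
      by (simp add: algebra_simps eval_nat_numeral)
    then show ?thesis unfolding Suc by (simp only: power_add power_one_right)
  qed
  finally show ?case by (simp add: numeral_3_eq_3 numeral_2_eq_2 algebra_simps)
qed

lemma run_sum_2:
  fixes q :: "'a::comm_ring_1"
  shows "(1 - q) * (1 - q ^ 2) * run_sum q 2 (L + 4) =
    q ^ 6 * (1 - q ^ (L + 2)) * (1 - q ^ (L + 1)) * (\<Prod>k<L. 1 + q ^ (k + 3))"
proof (induction L)
  case 0
  \<comment> \<open>The only subset of {1..4} with two run starts is {2, 4}; its sum explains the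
    factor \<open>q ^ 6\<close>.\<close>
  have "run_sum q 2 4 = q ^ 4 * run_sum q 1 2"
    using run_sum_rec[of q 1 2] run_sum_rec[of q 1 1] run_sum_rec[of q 1 0]
      run_sum_Suc_small[of 1 q 1] run_sum_Suc_small[of 1 q 0] run_sum_Suc_small[of 0 q 0]
    by (simp add: numeral_eq_Suc)
  then have "(1 - q) * (1 - q ^ 2) * run_sum q 2 4 =
      (1 - q ^ 2) * q ^ 4 * ((1 - q) * run_sum q 1 2)"
    by (simp only: mult_ac)
  also have "(1 - q) * run_sum q 1 2 = q ^ 2 * (1 - q)"
    using run_sum_1[of q 0] by (simp del: add_2_eq_Suc add_2_eq_Suc')
  also have "(1 - q ^ 2) * q ^ 4 * (q ^ 2 * (1 - q)) = q ^ 6 * (1 - q ^ 2) * (1 - q)"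
    by (simp add: algebra_simps eval_nat_numeral)
  finally show ?case by (simp add: power2_eq_square)
next
  case (Suc L)
  let ?P = "\<Prod>k<L. 1 + q ^ (k + 3)"
  have 1: "(1 - q) * run_sum q 1 (L + 3) = q ^ 2 * (1 - q ^ (L + 2)) * ((1 + q ^ 2) * ?P)"
  proof -
    have "(\<Prod>k<Suc L. 1 + q ^ (k + 2)) = (1 + q ^ 2) * ?P"
      unfolding prod.lessThan_Suc_shift by (simp add: numeral_eq_Suc)
    then show ?thesis
      using run_sum_1[of q "Suc L"] by (simp add: numeral_eq_Suc)
  qed
  have rec: "run_sum q 2 (L + 5) =
      (1 + q ^ (L + 5)) * run_sum q 2 (L + 4) + q ^ (L + 5) * run_sum q 1 (L + 3)"
    using run_sum_rec[of q 1 "L + 3"] by (simp add: numeral_eq_Suc)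
  have "(1 - q) * (1 - q ^ 2) * run_sum q 2 (L + 5) =
      (1 + q ^ (L + 5)) * ((1 - q) * (1 - q ^ 2) * run_sum q 2 (L + 4)) +
      (1 - q ^ 2) * q ^ (L + 5) * ((1 - q) * run_sum q 1 (L + 3))"
    unfolding rec by (simp add: algebra_simps)
  also have "\<dots> = q ^ 6 * (1 - q ^ (L + 3)) * (1 - q ^ (L + 2)) * ((1 + q ^ (L + 3)) * ?P)"
  proof -
    \<comment> \<open>Again \<open>x\<close> is \<open>q ^ L\<close>. Up to the factor
      \<open>q ^ 6 * (1 - x * q ^ 2) * P\<close> both sides are 1 - x^2 q^6.\<close>
    have "(1 + x * q ^ 5) * (q ^ 6 * (1 - x * q ^ 2) * (1 - x * q) * P) +
        (1 - q ^ 2) * (x * q ^ 5) * (q ^ 2 * (1 - x * q ^ 2) * ((1 + q ^ 2) * P)) =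
        q ^ 6 * (1 - x * q ^ 3) * (1 - x * q ^ 2) * ((1 + x * q ^ 3) * P)" for x P :: 'a
      by (simp add: algebra_simps eval_nat_numeral)
    then show ?thesis unfolding Suc 1 by (simp only: power_add power_one_right)
  qed
  finally show ?case by (simp add: numeral_eq_Suc algebra_simps)
qed

section \<open>Cells of hook length 2\<close>

text \<open>A hook length is arm plus leg plus 1, so the value 2 leaves arm 0 with leg 1, or arm 1
  with leg 0. Strictly decreasing rows exclude the former; in the latter, leg 0 says that no row has
  length \<open>j\<close>.\<close>

lemma hook_length_2_iff:
  assumes p: "sorted_wrt (>) p" and ij: "(i, j) \<in> cells p"
  shows "hook_length p i j = 2 \<longleftrightarrow> j = row_len p i - 1 \<and> row_len p i - 1 \<notin> set p"
proof -
  let ?C = "{k. (k, j) \<in> cells p}"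
  have gt: "p ! k > p ! l" if "k < l" "l < length p" for k l
    using p that by (simp add: sorted_wrt_iff_nth_less)
  have i: "1 \<le> i" "i \<le> length p" "1 \<le> j" "j \<le> p ! (i - 1)"
    using ij by (auto simp: cells_def row_len_def)
  have fin: "finite ?C"
    by (rule finite_subset[of _ "{1..length p}"]) (auto simp: cells_def)
  have sub: "{1..i} \<subseteq> ?C"
  proof
    fix k assume k: "k \<in> {1..i}"
    then have "p ! (i - 1) \<le> p ! (k - 1)"
      using gt[of "k - 1" "i - 1"] i by (cases "k = i") (auto simp: diff_less_mono less_imp_le)
    then show "k \<in> ?C" using k i by (auto simp: cells_def row_len_def)
  qed
  have le: "i \<le> card ?C" using card_mono[OF fin sub] by simp
  have h: "hook_length p i j = int (p ! (i - 1)) - int j + (int (card ?C) - int i) + 1"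
    by (simp add: hook_length_def row_len_def col_len_def)
  show ?thesis
  proof
    assume "hook_length p i j = 2"
    then consider "j = p ! (i - 1)" "card ?C = Suc i" | "Suc j = p ! (i - 1)" "card ?C = i"
      using h le i by linarith
    then show "j = row_len p i - 1 \<and> row_len p i - 1 \<notin> set p"
    proof cases
      case 1
      \<comment> \<open>Leg 1 puts a lower row in column \<open>j\<close>, hence at least as long as
        row \<open>i\<close>.\<close>
      then have "\<not> ?C \<subseteq> {1..i}" using card_mono[of "{1..i}" ?C] by auto
      then obtain k where "k \<in> ?C" "k \<notin> {1..i}" by blast
      then have "i < k" "k \<le> length p" "j \<le> p ! (k - 1)"
        by (auto simp: cells_def row_len_def)
      then have False using gt[of "i - 1" "k - 1"] 1 i by linarith
      then show ?thesis ..
    next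
      case 2
      then have C: "?C = {1..i}" using card_subset_eq[OF fin sub] by simp
      \<comment> \<open>A row of length \<open>j\<close> would meet column \<open>j\<close> and so
        be among the first \<open>i\<close> rows, all of which are longer than
        \<open>j\<close>.\<close>
      have "j \<notin> set p"
      proof
        assume "j \<in> set p"
        then obtain k where k: "k < length p" "p ! k = j" by (auto simp: in_set_conv_nth)
        then have "Suc k \<in> ?C" using i by (auto simp: cells_def row_len_def)
        then have "k = i - 1 \<or> k < i - 1 \<and> i - 1 < length p" unfolding C using i by auto
        then show False using gt[of k "i - 1"] k 2 i by auto
      qed
      moreover have "j = row_len p i - 1" unfolding row_len_def using 2(1) by linarith
      ultimately show ?thesis by simp
    qed
  next
    assume j: "j = row_len p i - 1 \<and> row_len p i - 1 \<notin> set p"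
    \<comment> \<open>A row below row \<open>i\<close> that reaches column \<open>j\<close> has
      length at least \<open>j\<close> and less than \<open>j + 1\<close>, so \<open>j\<close> would
      be a part.\<close>
    have "?C \<subseteq> {1..i}"
    proof
      fix k assume "k \<in> ?C"
      then have k: "1 \<le> k" "k \<le> length p" "j \<le> p ! (k - 1)"
        by (auto simp: cells_def row_len_def)
      have "k \<le> i"
      proof (rule ccontr)
        assume "\<not> k \<le> i"
        then have "p ! (k - 1) < p ! (i - 1)" using gt[of "i - 1" "k - 1"] k i by auto
        then have "p ! (k - 1) = j" using j k by (auto simp: row_len_def)
        moreover have "p ! (k - 1) \<in> set p" using k by auto
        ultimately show False using j by simp
      qed
      then show "k \<in> {1..i}" using k by simp
    qed
    then have "card ?C = i" using sub by (metis card_atLeastAtMost diff_Suc_1 subset_antisym)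
    then show "hook_length p i j = 2" using h j i by (simp add: row_len_def)
  qed
qed

text \<open>Sending a cell to the length of its row is a bijection: each row has at most one such
  cell, and distinct rows have distinct lengths.\<close>

lemma card_hook_length_2:
  assumes p: "sorted_wrt (>) p"
  shows "card {(i, j) \<in> cells p. hook_length p i j = 2} = card (run_starts (set p))"
proof (rule bij_betw_same_card)
  have inj: "k = l" if "p ! k = p ! l" "k < length p" "l < length p" for k l
    using p that by (metis linorder_neq_iff sorted_wrt_iff_nth_less)
  have "{(i, j) \<in> cells p. hook_length p i j = 2} =
      {(i, j) \<in> cells p. j = row_len p i - 1 \<and> row_len p i - 1 \<notin> set p}"
    using hook_length_2_iff[OF p] by auto
  also have "bij_betw (\<lambda>(i, j). row_len p i) \<dots> (run_starts (set p))"
    unfolding bij_betw_def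
  proof (intro conjI)
    show "inj_on (\<lambda>(i, j). row_len p i)
        {(i, j) \<in> cells p. j = row_len p i - 1 \<and> row_len p i - 1 \<notin> set p}"
      by (auto simp: inj_on_def cells_def row_len_def dest!: inj)
    show "(\<lambda>(i, j). row_len p i) `
        {(i, j) \<in> cells p. j = row_len p i - 1 \<and> row_len p i - 1 \<notin> set p} = run_starts (set p)"
    proof (intro equalityI subsetI)
      fix x assume "x \<in> run_starts (set p)"
      then obtain k where "k < length p" "x = p ! k" "2 \<le> x" "x - 1 \<notin> set p"
        by (auto simp: run_starts_def in_set_conv_nth)
      then show "x \<in> (\<lambda>(i, j). row_len p i) `
          {(i, j) \<in> cells p. j = row_len p i - 1 \<and> row_len p i - 1 \<notin> set p}"
        by (intro image_eqI[of _ _ "(Suc k, x - 1)"]) (auto simp: cells_def row_len_def)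
    qed (auto simp: run_starts_def cells_def row_len_def)
  qed
  finally show "bij_betw (\<lambda>(i, j). row_len p i)
      {(i, j) \<in> cells p. hook_length p i j = 2} (run_starts (set p))" .
qed

section \<open>From partitions to subsets\<close>

lemma sorted_wrt_greater_iff:
  "sorted_wrt (>) (p :: 'a::linorder list) \<longleftrightarrow> sorted_wrt (\<ge>) p \<and> distinct p"
  by (induction p) (auto simp: order.order_iff_strict)

lemma b2_eq_card_run_starts:
  "b2 L m n = card {S \<in> Pow {1..L}. \<Sum>S = n \<and> card (run_starts S) = m}"
proof -
  have "b2 L m n = card {p. sorted_wrt (>) p \<and> set p \<subseteq> {1..L} \<and> \<Sum>(set p) = n \<and>
      card (run_starts (set p)) = m}"
    unfolding b2_def
    by (rule arg_cong[of _ _ card])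
      (auto simp: is_partition_def sorted_wrt_greater_iff card_hook_length_2
        distinct_sum_list_conv_Sum subset_iff Suc_le_eq)
  also have "\<dots> = card {S \<in> Pow {1..L}. \<Sum>S = n \<and> card (run_starts S) = m}"
  proof (rule bij_betw_same_card[of set], rule bij_betwI'[rotated 2])
    fix S assume S: "S \<in> {S \<in> Pow {1..L}. \<Sum>S = n \<and> card (run_starts S) = m}"
    then have "finite S" using finite_subset by blast
    then show "\<exists>p\<in>{p. sorted_wrt (>) p \<and> set p \<subseteq> {1..L} \<and> \<Sum>(set p) = n \<and>
      card (run_starts (set p)) = m}. S = set p"
      using S by (intro bexI[of _ "rev (sorted_list_of_set S)"]) (auto simp: sorted_wrt_rev)
  next
    fix p r :: "nat list"
    assume "p \<in> {p. sorted_wrt (>) p \<and> set p \<subseteq> {1..L} \<and> \<Sum>(set p) = n \<and>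
        card (run_starts (set p)) = m}"
      and "r \<in> {p. sorted_wrt (>) p \<and> set p \<subseteq> {1..L} \<and> \<Sum>(set p) = n \<and>
        card (run_starts (set p)) = m}"
    then have "sorted_wrt (<) (rev p)" "sorted_wrt (<) (rev r)"
      by (auto simp: sorted_wrt_rev)
    then show "set p = set r \<longleftrightarrow> p = r"
      by (metis rev_rev_ident set_rev strict_sorted_equal)
  qed auto
  finally show ?thesis .
qed

text \<open>Only the finitely many pairs \<open>(\<Sum>S, card (run_starts S))\<close> give nonzero
  terms, so the infinite sum is a finite one, obtained by grouping the subsets by this pair.\<close>

lemma has_sum_b2:
  "((\<lambda>(n, m). fps_const (of_nat (m choose j) * of_nat (b2 L m n)) * fps_X ^ n)
      has_sum run_sum (fps_X :: 'a::field fps) j L) UNIV"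
proof (rule has_sum_finite_neutralI)
  let ?g = "\<lambda>S. (\<Sum>S, card (run_starts S))"
  show "finite (?g ` Pow {1..L})" by simp
  show "(case x of (n, m) \<Rightarrow> fps_const (of_nat (m choose j) * of_nat (b2 L m n)) *
      (fps_X :: 'a fps) ^ n) = 0" if "x \<in> UNIV - ?g ` Pow {1..L}" for x
  proof (cases x)
    case (Pair n m)
    then have "{S \<in> Pow {1..L}. \<Sum>S = n \<and> card (run_starts S) = m} = {}" using that by auto
    then show ?thesis unfolding Pair prod.case b2_eq_card_run_starts by (simp only:) simp
  qed
  have "run_sum (fps_X :: 'a fps) j L = (\<Sum>x\<in>?g ` Pow {1..L}. \<Sum>S | S \<in> Pow {1..L} \<and> ?g S = x.
      of_nat (card (run_starts S) choose j) * fps_X ^ \<Sum>S)"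
    unfolding run_sum_def by (rule sum.image_gen) simp
  also have "\<dots> = (\<Sum>x\<in>?g ` Pow {1..L}. case x of (n, m) \<Rightarrow>
      fps_const (of_nat (m choose j) * of_nat (b2 L m n)) * fps_X ^ n)"
    by (intro sum.cong)
      (auto simp: b2_eq_card_run_starts algebra_simps simp flip: fps_of_nat fps_const_mult)
  finally show "run_sum (fps_X :: 'a fps) j L = (\<Sum>x\<in>?g ` Pow {1..L}. case x of (n, m) \<Rightarrow>
      fps_const (of_nat (m choose j) * of_nat (b2 L m n)) * fps_X ^ n)" .
qed simp

section \<open>The Gaussian binomial and the final identity\<close>

lemma q_binomial_2_mult:
  "(1 - fps_X) * (1 - fps_X ^ 2) * q_binomial (int L + 2) 2 (fps_X :: 'a::field fps) =
    (1 - fps_X ^ (L + 2)) * (1 - fps_X ^ (L + 1))"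
proof -
  define P :: "'a fps" where "P = (\<Prod>k<L. 1 - fps_X * fps_X ^ k)"
  define D :: "'a fps" where "D = (1 - fps_X) * (1 - fps_X ^ 2) * P"
  have nat: "nat (int L + 2) = Suc (Suc L)" by simp
  have P: "q_pochhammer fps_X fps_X (int L) = P"
    "q_pochhammer fps_X fps_X (int L + 2) = (1 - fps_X ^ (L + 2)) * (1 - fps_X ^ (L + 1)) * P"
    "q_pochhammer fps_X (fps_X :: 'a fps) 2 = (1 - fps_X) * (1 - fps_X ^ 2)"
    unfolding q_pochhammer_def nat by (simp_all add: P_def numeral_2_eq_2 algebra_simps)
  have "fps_nth P 0 = 1"
    unfolding P_def by (induction L) (simp_all add: fps_mult_nth_0)
  \<comment> \<open>A nonzero constant term makes \<open>D\<close> a unit, so the \<open>div\<close>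
    in \<open>q_binomial\<close> is exact; \<open>P\<close> is then cancelled.\<close>
  then have "fps_nth D 0 \<noteq> 0" "P \<noteq> 0"
    by (auto simp: D_def fps_mult_nth_0)
  moreover have "D * q_binomial (int L + 2) 2 fps_X =
      ((1 - fps_X ^ (L + 2)) * (1 - fps_X ^ (L + 1)) * P)"
    using \<open>fps_nth D 0 \<noteq> 0\<close>
    by (simp add: q_binomial_def P D_def[symmetric] fps_divide_unit inverse_mult_eq_1'
        mult.left_commute[of D])
  ultimately show ?thesis by (simp add: D_def mult.assoc)
qed

theorem theorem2p5:
  fixes L :: nat
  assumes "L > 0"
  shows "((\<lambda>(n, m). fps_const (of_nat (m choose 2) * of_nat (b2 L m n)) * fps_X ^ n)
           has_sum
          (fps_X ^ 6 * q_binomial (int L - 2) 2 fps_X * q_pochhammer (- (fps_X ^ 3)) fps_X (int L - 4)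
             :: rat fps)) (UNIV :: (nat \<times> nat) set)"
proof -
  have "run_sum fps_X 2 L =
      (fps_X ^ 6 * q_binomial (int L - 2) 2 fps_X * q_pochhammer (- (fps_X ^ 3)) fps_X (int L - 4)
        :: rat fps)"
  proof (cases "L \<le> 3")
    case True
    \<comment> \<open>Two run starts require \<open>L\<close> to be at least 4, and the binomial on
      the right is 0 by definition as its upper index is below 2.\<close>
    have "run_sum fps_X 2 L = (0 :: rat fps)"
    proof -
      consider "L \<le> 1" | "L = 2" | "L = 3" using True by linarith
      then show ?thesis
        using run_sum_rec[of "fps_X :: rat fps" 1 1] run_sum_rec[of "fps_X :: rat fps" 1 0]
          run_sum_Suc_small[of _ "fps_X :: rat fps" 1] run_sum_Suc_small[of _ "fps_X :: rat fps" 0]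
        by cases (simp_all add: numeral_eq_Suc)
    qed
    then show ?thesis using True by (simp add: q_binomial_def)
  next
    case False
    then obtain K where L: "L = K + 4" using that[of "L - 4"] by simp
    let ?c = "(1 - fps_X) * (1 - fps_X ^ 2) :: rat fps"
    have "q_pochhammer (- (fps_X ^ 3)) fps_X (int K) = (\<Prod>k<K. 1 + (fps_X :: rat fps) ^ (k + 3))"
      by (simp add: q_pochhammer_def power_add mult.commute)
    then have "?c * run_sum fps_X 2 L = fps_X ^ 6 * (?c * q_binomial (int K + 2) 2 fps_X) *
        q_pochhammer (- (fps_X ^ 3)) fps_X (int K)"
      unfolding L q_binomial_2_mult run_sum_2 by (simp only: mult.assoc)
    then have "?c * run_sum fps_X 2 L = ?c * (fps_X ^ 6 * q_binomial (int K + 2) 2 fps_X *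
        q_pochhammer (- (fps_X ^ 3)) fps_X (int K))"
      by (simp only: mult_ac)
    moreover have "?c \<noteq> 0"
    proof -
      have "fps_nth ?c 0 \<noteq> 0" by (simp add: fps_mult_nth_0)
      then show ?thesis by force
    qed
    moreover have "int L - 2 = int K + 2" "int L - 4 = int K" by (simp_all add: L)
    ultimately show ?thesis by (simp only: mult_cancel_left simp_thms)
  qed
  then show ?thesis using has_sum_b2[of 2 L, where ?'a = rat] by simp
qed

end
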